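(* Let $\Gamma\subset \mathrm{PSL}(2,\mathbb{R})$ be the monodromy group of a family of rank 19 lattice polarised (complex) K3 surfaces. Then $$\operatorname{trace}(A)^2\in\mathbb{Z}\qquad\text{for all } A\in\Gamma .$$ (The quantity $\operatorname{trace}(A)^2$ is well defined for $A\in\mathrm{PSL}(2,\mathbb{R})$.)
   Context: A K3 surface is a simply-connected compact complex surface with trivial canonical bundle. $\Lambda_{K3}=(-E_8)^2\oplus U^3$ is the K3 lattice, isometric to $H^2(X,\mathbb{Z})$ for every K3 surface $X$. For a lattice $S$ of signature $(1,k-1)$, an $S$-polarisation of a K3 surface $X$ is a primitive embedding $S\hookrightarrow\operatorname{Pic}(X)$. Fix a primitive sublattice $S\subset\Lambda_{K3}$ of signature $(1,18)$ (rank 19) and put $T=S^\perp\subset\Lambda_{K3}$, a lattice of rank 3 and signature $(2,1)$. The period space of $S$-polarised K3 surfaces is $$D_S=\{\omega\in\mathbb{P}(T\otimes\mathbb{C}) : \langle\omega,\omega\rangle=0,\ \langle\omega,\bar\omega\rangle>0\},$$ and the coarse moduli space is $D_S/\Gamma_S$, where $\Gamma_S\subset O(T)$ is the group of automorphisms of $T$ induced by isometries of $\Lambda_{K3}$ that fix $S$ pointwise; equivalently $\Gamma_S$ is the kernel of the natural map $O(T)\to\operatorname{Aut}(T^*/T)$. As $T$ has odd rank, $SO(T)=O(T)/\{\pm \mathrm{id}\}$, and $\Gamma_S$ is regarded as acting through $SO(T)$. Let $R=\begin{pmatrix}0&0&-1\\0&1&0\\-1&0&0\end{pmatrix}$ and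 let $\varphi:\mathrm{PSL}(2,\mathbb{R})\to SO(R)\otimes\mathbb{R}$ be $$\begin{pmatrix}a&b\\c&d\end{pmatrix}\mapsto\begin{pmatrix}a^2&\sqrt2ab&b^2\\ \sqrt2ac&ad+bc&\sqrt2bd\\ c^2&\sqrt2cd&d^2\end{pmatrix}.$$ Choose $P\in \mathrm{GL}(3,\mathbb{R})$ with ${}^tP\,T\,P=R$ (where $T$ also denotes the Gram matrix of the lattice $T$) and let $\Phi=P\varphi P^{-1}:\mathrm{PSL}(2,\mathbb{R})\to SO(T)\otimes\mathbb{R}$. The Picard–Fuchs equation of a one-parameter family of $S$-polarised K3 surfaces has order 3 and is the symmetric square of a second order ODE. The monodromy group $\Gamma\subset\mathrm{PSL}(2,\mathbb{R})$ of the family is the projective monodromy group of this second order ODE; up to conjugation in $\mathrm{PSL}(2,\mathbb{R})$ the paper identifies it with $\Phi^{-1}(\Gamma_S)\subset\Phi^{-1}(SO(T))$, so that $D_S/\Gamma_S=\mathcal{H}/\Phi^{-1}(\Gamma_S)$ with $\mathcal{H}$ the upper half plane. *)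

theory Defs
  imports "HOL-Analysis.Analysis"
begin

section \<open>The K3 lattice and its sublattices\<close>

definition e8_form :: "int ^ 8 \<Rightarrow> int ^ 8 \<Rightarrow> int" where
  "e8_form x y = 2 * (\<Sum>i\<in>UNIV. x $ i * y $ i)
     - (\<Sum>(i, j)\<in>{(1, 3), (3, 4), (2, 4), (4, 5), (5, 6), (6, 7), (7, 8)}. x $ i * y $ j + x $ j * y $ i)"

text \<open>Coordinates \<open>Inl (k, i)\<close> belong to the \<open>k\<close>-th copy of \<open>-E8\<close>, coordinates \<open>Inr (k, i)\<close> to the
  \<open>k\<close>-th hyperbolic plane \<open>U\<close>.  In \<open>e8_form\<close> the nodes of the Dynkin diagram are numbered as in
  Bourbaki.\<close>

type_synonym k3_lattice = "int ^ ((2 \<times> 8) + (3 \<times> 2))"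

definition k3_form :: "k3_lattice \<Rightarrow> k3_lattice \<Rightarrow> int" where
  "k3_form x y =
     - (\<Sum>k\<in>UNIV. e8_form (\<chi> i. x $ Inl (k, i)) (\<chi> i. y $ Inl (k, i)))
     + (\<Sum>k\<in>UNIV. x $ Inr (k, 1) * y $ Inr (k, 2) + x $ Inr (k, 2) * y $ Inr (k, 1))"

definition zbasis :: "('n::finite \<Rightarrow> k3_lattice) \<Rightarrow> k3_lattice set \<Rightarrow> bool" where
  "zbasis v L \<longleftrightarrow> bij_betw (\<lambda>c :: int ^ 'n. \<Sum>i\<in>UNIV. c $ i *s v i) UNIV L"

definition gram :: "('n::finite \<Rightarrow> k3_lattice) \<Rightarrow> int ^ 'n ^ 'n" where
  "gram v = (\<chi> i j. k3_form (v i) (v j))"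

definition has_signature :: "real ^ 'n::finite ^ 'n \<Rightarrow> nat \<Rightarrow> nat \<Rightarrow> bool" where
  "has_signature G p q \<longleftrightarrow>
     (\<exists>Q :: real ^ 'n ^ 'n. invertible Q \<and>
        (let D = transpose Q ** G ** Q in
           (\<forall>i j. i \<noteq> j \<longrightarrow> D $ i $ j = 0) \<and>
           card {i. D $ i $ i > 0} = p \<and> card {i. D $ i $ i < 0} = q))"

definition primitive_in_k3 :: "k3_lattice set \<Rightarrow> bool" where
  "primitive_in_k3 S \<longleftrightarrow> (\<forall>n x. n \<noteq> 0 \<and> n *s x \<in> S \<longrightarrow> x \<in> S)"

definition rank19_polarisation :: "k3_lattice set \<Rightarrow> bool" where
  "rank19_polarisation S \<longleftrightarrow> primitive_in_k3 S \<and>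
     (\<exists>s :: 19 \<Rightarrow> k3_lattice. zbasis s S \<and> has_signature (map_matrix real_of_int (gram s)) 1 18)"

definition orth :: "k3_lattice set \<Rightarrow> k3_lattice set" where
  "orth S = {x. \<forall>s\<in>S. k3_form x s = 0}"

definition k3_isometry :: "(k3_lattice \<Rightarrow> k3_lattice) \<Rightarrow> bool" where
  "k3_isometry F \<longleftrightarrow> bij F \<and> (\<forall>x y. F (x + y) = F x + F y) \<and> (\<forall>x y. k3_form (F x) (F y) = k3_form x y)"

text \<open>The group \<open>\<Gamma>\<^sub>S\<close> of automorphisms of \<open>T = orth S\<close> induced by isometries fixing \<open>S\<close> pointwise.
  Here and below \<open>t\<close> is a basis of \<open>T\<close>, and automorphisms of \<open>T\<close> are written as matrices acting on
  coordinate columns.\<close>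

definition Gamma_S :: "k3_lattice set \<Rightarrow> (3 \<Rightarrow> k3_lattice) \<Rightarrow> (int ^ 3 ^ 3) set" where
  "Gamma_S S t = {g. \<exists>F. k3_isometry F \<and> (\<forall>s\<in>S. F s = s) \<and>
                        (\<forall>j. F (t j) = (\<Sum>i\<in>UNIV. g $ i $ j *s t i))}"

section \<open>The group \<open>PSL(2,\<real>)\<close>\<close>

text \<open>Elements of \<open>PSL(2,\<real>)\<close> are the classes \<open>{A, -A}\<close> with \<open>det A = 1\<close>.\<close>

definition psl :: "real ^ 2 ^ 2 \<Rightarrow> (real ^ 2 ^ 2) set" where
  "psl A = {A, - A}"

section \<open>Families and the monodromy of the Picard--Fuchs equation\<close>

text \<open>The base of a family is a Riemann surface \<open>B\<close> with a parameter \<open>lam\<close> on it, given by its universal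
  covering \<open>\<pi> : U \<rightarrow> B\<close> with \<open>U\<close> an open subset of the complex plane.  Singular fibres, critical points
  of the parameter and singular points of the differential equations are removed from \<open>B\<close>.  The complex
  structure of \<open>B\<close> is the one for which \<open>lam\<close> is a local coordinate.  Multivalued functions on \<open>B\<close> are
  functions on \<open>U\<close>, and continuation along loops is composition with deck transformations.\<close>

definition family_base :: "complex set \<Rightarrow> (complex \<Rightarrow> 'b) \<Rightarrow> 'b::t2_space set \<Rightarrow> ('b \<Rightarrow> complex) \<Rightarrow> bool" where
  "family_base U \<pi> B lam \<longleftrightarrow>
     open U \<and> U \<noteq> {} \<and> simply_connected U \<and> covering_space U \<pi> B \<and>
     (\<lambda>u. lam (\<pi> u)) holomorphic_on U \<and> (\<forall>u\<in>U. deriv (\<lambda>v. lam (\<pi> v)) u \<noteq> 0)"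

definition deck_transformation :: "complex set \<Rightarrow> (complex \<Rightarrow> 'b) \<Rightarrow> (complex \<Rightarrow> complex) \<Rightarrow> bool" where
  "deck_transformation U \<pi> \<gamma> \<longleftrightarrow> (\<exists>\<gamma>'. homeomorphism U U \<gamma> \<gamma>') \<and> (\<forall>u\<in>U. \<pi> (\<gamma> u) = \<pi> u)"

text \<open>The period datum of a family of \<open>S\<close>-polarised K3 surfaces over \<open>B\<close>: \<open>\<omega> u\<close> is the class of a
  nowhere vanishing holomorphic 2-form on the fibre over \<open>\<pi> u\<close>, depending holomorphically on \<open>\<pi> u\<close>.  It is
  transported along loops by isometries of the K3 lattice that fix \<open>S\<close> pointwise.\<close>

definition period_datum ::
    "k3_lattice set \<Rightarrow> (3 \<Rightarrow> k3_lattice) \<Rightarrow> complex set \<Rightarrow> (complex \<Rightarrow> 'b) \<Rightarrow> (complex \<Rightarrow> complex ^ 3) \<Rightarrow> bool" where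
  "period_datum S t U \<pi> \<omega> \<longleftrightarrow>
     (\<forall>i. (\<lambda>u. \<omega> u $ i) holomorphic_on U) \<and>
     (\<forall>u\<in>U. (\<Sum>i\<in>UNIV. \<Sum>j\<in>UNIV. of_int (gram t $ i $ j) * \<omega> u $ i * \<omega> u $ j) = 0 \<and>
             Re (\<Sum>i\<in>UNIV. \<Sum>j\<in>UNIV. of_int (gram t $ i $ j) * \<omega> u $ i * cnj (\<omega> u $ j)) > 0) \<and>
     (\<forall>\<gamma>. deck_transformation U \<pi> \<gamma> \<longrightarrow>
        (\<exists>g\<in>Gamma_S S t. \<forall>u\<in>U. \<omega> (\<gamma> u) = map_matrix of_int g *v \<omega> u))"

definition period :: "(3 \<Rightarrow> k3_lattice) \<Rightarrow> (complex \<Rightarrow> complex ^ 3) \<Rightarrow> 3 \<Rightarrow> complex \<Rightarrow> complex" where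
  "period t \<omega> i u = (\<Sum>j\<in>UNIV. of_int (gram t $ i $ j) * \<omega> u $ j)"

definition dparam :: "(complex \<Rightarrow> 'b) \<Rightarrow> ('b \<Rightarrow> complex) \<Rightarrow> (complex \<Rightarrow> complex) \<Rightarrow> complex \<Rightarrow> complex" where
  "dparam \<pi> lam y u = deriv y u / deriv (\<lambda>v. lam (\<pi> v)) u"

text \<open>A list \<open>c\<close> of length \<open>n\<close> of holomorphic functions on \<open>B\<close> stands for the equation
  \<open>y\<^sup>(\<^sup>n\<^sup>) + c ! (n-1) y\<^sup>(\<^sup>n\<^sup>-\<^sup>1\<^sup>) + \<dots> + c ! 0 y = 0\<close>.\<close>

definition ode :: "complex set \<Rightarrow> (complex \<Rightarrow> 'b) \<Rightarrow> nat \<Rightarrow> ('b \<Rightarrow> complex) list \<Rightarrow> bool" where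
  "ode U \<pi> n c \<longleftrightarrow> length c = n \<and> (\<forall>i<n. (\<lambda>u. (c ! i) (\<pi> u)) holomorphic_on U)"

definition ode_solution ::
    "complex set \<Rightarrow> (complex \<Rightarrow> 'b) \<Rightarrow> ('b \<Rightarrow> complex) \<Rightarrow> ('b \<Rightarrow> complex) list \<Rightarrow> (complex \<Rightarrow> complex) \<Rightarrow> bool" where
  "ode_solution U \<pi> lam c y \<longleftrightarrow>
     y holomorphic_on U \<and>
     (\<forall>u\<in>U. (dparam \<pi> lam ^^ length c) y u
              + (\<Sum>i<length c. (c ! i) (\<pi> u) * (dparam \<pi> lam ^^ i) y u) = 0)"

text \<open>The Picard--Fuchs equation is the equation whose solution space is spanned by the periods.\<close>

definition picard_fuchs ::
    "(3 \<Rightarrow> k3_lattice) \<Rightarrow> complex set \<Rightarrow> (complex \<Rightarrow> 'b) \<Rightarrow> ('b \<Rightarrow> complex) \<Rightarrow> (complex \<Rightarrow> complex ^ 3) \<Rightarrow>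
     ('b \<Rightarrow> complex) list \<Rightarrow> bool" where
  "picard_fuchs t U \<pi> lam \<omega> L \<longleftrightarrow>
     ode U \<pi> 3 L \<and>
     (\<forall>y. ode_solution U \<pi> lam L y \<longleftrightarrow>
            (\<exists>c :: complex ^ 3. \<forall>u\<in>U. y u = (\<Sum>i\<in>UNIV. c $ i * period t \<omega> i u)))"

text \<open>\<open>L\<close> is the symmetric square of the second order equation \<open>K\<close>: its solution space is spanned by the
  products of two solutions of \<open>K\<close>.\<close>

definition symmetric_square ::
    "complex set \<Rightarrow> (complex \<Rightarrow> 'b) \<Rightarrow> ('b \<Rightarrow> complex) \<Rightarrow> ('b \<Rightarrow> complex) list \<Rightarrow> ('b \<Rightarrow> complex) list \<Rightarrow> bool" where
  "symmetric_square U \<pi> lam K L \<longleftrightarrow>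
     ode U \<pi> 2 K \<and> ode U \<pi> 3 L \<and>
     (\<forall>y. ode_solution U \<pi> lam L y \<longleftrightarrow>
            (\<exists>f g \<alpha> \<beta> \<gamma>. ode_solution U \<pi> lam K f \<and> ode_solution U \<pi> lam K g \<and>
               (\<forall>u\<in>U. y u = \<alpha> * (f u)\<^sup>2 + \<beta> * (f u * g u) + \<gamma> * (g u)\<^sup>2)))"

definition fundamental_system ::
    "complex set \<Rightarrow> (complex \<Rightarrow> 'b) \<Rightarrow> ('b \<Rightarrow> complex) \<Rightarrow> ('b \<Rightarrow> complex) list \<Rightarrow> (complex \<Rightarrow> complex ^ 2) \<Rightarrow> bool" where
  "fundamental_system U \<pi> lam K f \<longleftrightarrow>
     (\<forall>i. ode_solution U \<pi> lam K (\<lambda>u. f u $ i)) \<and>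
     (\<forall>c :: complex ^ 2. (\<forall>u\<in>U. (\<Sum>i\<in>UNIV. c $ i * f u $ i) = 0) \<longrightarrow> c = 0)"

definition continues_by ::
    "complex set \<Rightarrow> (complex \<Rightarrow> complex ^ 2) \<Rightarrow> (complex \<Rightarrow> complex) \<Rightarrow> real ^ 2 ^ 2 \<Rightarrow> bool" where
  "continues_by U f \<gamma> A \<longleftrightarrow>
     det A = 1 \<and> (\<exists>c::complex. c \<noteq> 0 \<and> (\<forall>u\<in>U. f (\<gamma> u) = c *s (map_matrix complex_of_real A *v f u)))"

text \<open>The projective monodromy group of the second order equation whose symmetric square is the
  Picard--Fuchs equation, in a fundamental system for which this group lies in \<open>PSL(2,\<real>)\<close>.\<close>

definition picard_fuchs_monodromy ::
    "k3_lattice set \<Rightarrow> (3 \<Rightarrow> k3_lattice) \<Rightarrow> 'b::t2_space set \<Rightarrow> (real ^ 2 ^ 2) set set \<Rightarrow> bool" where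
  "picard_fuchs_monodromy S t B \<Gamma> \<longleftrightarrow>
     (\<exists>U \<pi> lam \<omega> L K f.
        family_base U \<pi> B lam \<and> period_datum S t U \<pi> \<omega> \<and>
        picard_fuchs t U \<pi> lam \<omega> L \<and> symmetric_square U \<pi> lam K L \<and>
        fundamental_system U \<pi> lam K f \<and>
        (\<forall>\<gamma>. deck_transformation U \<pi> \<gamma> \<longrightarrow> (\<exists>A. continues_by U f \<gamma> A)) \<and>
        \<Gamma> = {psl A | A. \<exists>\<gamma>. deck_transformation U \<pi> \<gamma> \<and> continues_by U f \<gamma> A})"

section \<open>The monodromy group as a subgroup of \<open>\<Phi>\<^sup>-\<^sup>1(SO(T))\<close>\<close>

definition R_form :: "real ^ 3 ^ 3" where
  "R_form = vector [vector [0, 0, -1], vector [0, 1, 0], vector [-1, 0, 0]]"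

definition phi :: "real ^ 2 ^ 2 \<Rightarrow> real ^ 3 ^ 3" where
  "phi A = (let a = A $ 1 $ 1; b = A $ 1 $ 2; c = A $ 2 $ 1; d = A $ 2 $ 2 in
     vector [vector [a\<^sup>2, sqrt 2 * a * b, b\<^sup>2],
             vector [sqrt 2 * a * c, a * d + b * c, sqrt 2 * b * d],
             vector [c\<^sup>2, sqrt 2 * c * d, d\<^sup>2]])"

definition Phi :: "real ^ 3 ^ 3 \<Rightarrow> real ^ 2 ^ 2 \<Rightarrow> real ^ 3 ^ 3" where
  "Phi P A = P ** phi A ** matrix_inv P"

text \<open>As \<open>SO(T)\<close> is identified with \<open>O(T)\<close> modulo \<open>\<plusminus>id\<close>, an element of \<open>SO(T)\<close> comes from \<open>\<Gamma>\<^sub>S\<close> if it or its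
  negative lies in \<open>\<Gamma>\<^sub>S\<close>.\<close>

definition Phi_preimage :: "k3_lattice set \<Rightarrow> (3 \<Rightarrow> k3_lattice) \<Rightarrow> real ^ 3 ^ 3 \<Rightarrow> (real ^ 2 ^ 2) set set" where
  "Phi_preimage S t P =
     {psl A | A. det A = 1 \<and>
        (\<exists>g\<in>Gamma_S S t. Phi P A = map_matrix real_of_int g \<or> Phi P A = - map_matrix real_of_int g)}"

definition moduli_monodromy ::
    "k3_lattice set \<Rightarrow> (3 \<Rightarrow> k3_lattice) \<Rightarrow> (real ^ 2 ^ 2) set set \<Rightarrow> bool" where
  "moduli_monodromy S t \<Gamma> \<longleftrightarrow>
     (\<exists>P h. transpose P ** map_matrix real_of_int (gram t) ** P = R_form \<and> det h = 1 \<and>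
        \<Gamma> = (\<lambda>X. (\<lambda>A. h ** A ** matrix_inv h) ` X) ` Phi_preimage S t P)"

end

theory Submission
  imports Defs "HOL-Complex_Analysis.Conformal_Mappings"
begin

text \<open>A matrix \<open>A\<close> of determinant 1 satisfies \<open>tr (phi A) = (tr A)\<^sup>2 - 1\<close> and \<open>det (phi A) = 1\<close>, so it is
  enough that \<open>phi A\<close> is conjugate, up to sign, to an integer matrix.  For \<open>\<Phi>\<^sup>-\<^sup>1(\<Gamma>\<^sub>S)\<close> this is immediate.
  For the monodromy of a Picard--Fuchs equation, let \<open>f\<close> be the fundamental system and
  \<open>q = (f\<^sub>1\<^sup>2, \<surd>2 f\<^sub>1 f\<^sub>2, f\<^sub>2\<^sup>2)\<close>.  Its components are linearly independent, and they are combinations of the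
  coordinates of \<open>\<omega>\<close>, so \<open>q = N \<omega>\<close> with \<open>N\<close> invertible.  Continuation multiplies \<open>q\<close> by \<open>c\<^sup>2 phi A\<close> and
  \<open>\<omega>\<close> by an integer matrix \<open>g\<close>, hence \<open>c\<^sup>2 phi A\<close> is conjugate to \<open>g\<close>.  Continuation along the inverse loop
  shows \<open>det g = \<plusminus>1\<close>, so \<open>\<bar>c\<bar> = 1\<close>, and taking absolute values of traces gives
  \<open>\<bar>(tr A)\<^sup>2 - 1\<bar> = \<bar>tr g\<bar>\<close>.\<close>

section \<open>Traces and determinants under similarity and under \<open>phi\<close>\<close>

lemma trace_map_matrix_of_int:
  "trace (map_matrix of_int M :: 'a::comm_ring_1 ^ 'n ^ 'n) = of_int (trace M)"
  by (simp add: trace_def)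

lemma det_map_matrix_of_int:
  "det (map_matrix of_int M :: 'a::comm_ring_1 ^ 'n ^ 'n) = of_int (det M)"
  by (simp add: det_def)

lemma trace_similar:
  fixes M N P :: "'a::comm_ring_1 ^ 'n ^ 'n"
  assumes "M ** P = P ** N" "invertible P"
  shows "trace M = trace N"
proof -
  obtain Q where Q: "P ** Q = mat 1" "Q ** P = mat 1"
    using assms(2) by (auto simp: invertible_def)
  have "M = P ** (N ** Q)"
    by (metis Q(1) assms(1) matrix_mul_assoc matrix_mul_rid)
  then have "trace M = trace (N ** Q ** P)"
    using trace_mul_sym[of P "N ** Q"] by simp
  also have "\<dots> = trace N"
    by (simp add: Q flip: matrix_mul_assoc)
  finally show ?thesis .
qed

lemma det_similar:
  fixes M N P :: "'a::field ^ 'n ^ 'n"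
  assumes "M ** P = P ** N" "invertible P"
  shows "det M = det N"
  using arg_cong[OF assms(1), of det] assms(2) by (simp add: det_mul invertible_det_nz)

lemma matrix_inv_right_mult:
  assumes "invertible P"
  shows "M ** matrix_inv P ** P = M"
proof -
  have "matrix_inv P ** P = mat 1"
    using assms unfolding invertible_def matrix_inv_def by (rule someI2_ex) blast
  then show ?thesis
    by (simp flip: matrix_mul_assoc)
qed

text \<open>\<open>phi A\<close> is the symmetric square of \<open>A\<close>: eigenvalues l, m of
  \<open>A\<close> give l^2, l m, m^2, with sum (l + m)^2 - l m and product (l m)^3.\<close>

lemma trace_phi:
  assumes "det A = 1"
  shows "trace (phi A) = (trace A)\<^sup>2 - 1"
  using assms by (simp add: phi_def trace_def det_2 Let_def sum_2 sum_3 power2_eq_square algebra_simps)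

lemma det_phi: "det (phi A) = det A ^ 3"
proof -
  have [simp]: "sqrt 2 * (sqrt 2 * x) = 2 * x" for x
    by (simp flip: mult.assoc)
  show ?thesis
    by (simp add: phi_def det_2 det_3 Let_def power2_eq_square power3_eq_cube algebra_simps)
qed

text \<open>The squared trace does not see the sign, so one representative with property
  \<open>Q\<close> serves both members of a class.\<close>

lemma trace_square_psl:
  assumes "X \<in> {psl A | A. Q A}" "A \<in> X"
  obtains A' where "Q A'" "(trace A)\<^sup>2 = (trace A')\<^sup>2"
proof -
  obtain A' where "Q A'" and "A = A' \<or> A = - A'"
    using assms by (auto simp: psl_def)
  then show thesis
    using that by (auto simp: trace_def sum_2 power2_eq_square algebra_simps)
qed

section \<open>Quadratic relations between independent holomorphic functions\<close>

lemma holomorphic_mult_eq_0: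
  assumes "open U" "connected U" "f holomorphic_on U" "g holomorphic_on U"
    and fg: "\<And>u. u \<in> U \<Longrightarrow> f u * g u = 0"
  shows "(\<forall>u\<in>U. f u = 0) \<or> (\<forall>u\<in>U. g u = 0)"
proof (rule disjCI)
  assume "\<not> (\<forall>u\<in>U. g u = 0)"
  then obtain w where w: "w \<in> U" "g w \<noteq> 0"
    by blast
  \<comment> \<open>On this nonempty open set \<open>f\<close> vanishes; the identity theorem
    carries this over to the connected set \<open>U\<close>.\<close>
  let ?V = "U \<inter> g -` (- {0})"
  show "\<forall>u\<in>U. f u = 0"
  proof
    fix u assume "u \<in> U"
    show "f u = 0"
    proof (rule analytic_continuation_open[of ?V U f "\<lambda>_. 0"])
      show "open ?V"
        using assms by (intro continuous_open_preimage holomorphic_on_imp_continuous_on) auto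
      show "?V \<noteq> {}"
        using w by blast
      show "f z = 0" if "z \<in> ?V" for z
        using fg[of z] that by simp
    qed (use assms \<open>u \<in> U\<close> in auto)
  qed
qed

lemma binary_quadratic_factorization:
  fixes \<alpha> \<beta> \<gamma> :: complex
  obtains a b c d where "\<alpha> = a * c" "\<beta> = a * d + b * c" "\<gamma> = b * d"
proof (cases "\<alpha> = 0")
  case True
  then show thesis
    by (intro that[where a = 0 and b = 1 and c = \<beta> and d = \<gamma>]) auto
next
  case False
  define s where "s = csqrt (\<beta>\<^sup>2 - 4 * \<alpha> * \<gamma>)"
  have s: "s * s = \<beta>\<^sup>2 - 4 * \<alpha> * \<gamma>"
    by (simp add: s_def flip: power2_eq_square)
  \<comment> \<open>With s^2 the discriminant, the form \<alpha> X^2 + \<beta> X Y + \<gamma> Y^2 is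
    (\<alpha> X + (\<beta> + s)/2 Y) (X + (\<beta> - s)/(2 \<alpha>) Y).\<close>
  show thesis
  proof (rule that)
    show "\<alpha> = \<alpha> * 1"
      by simp
    show "\<beta> = \<alpha> * ((\<beta> - s) / (2 * \<alpha>)) + (\<beta> + s) / 2 * 1"
      using False by (simp add: field_simps)
    show "\<gamma> = (\<beta> + s) / 2 * ((\<beta> - s) / (2 * \<alpha>))"
      using False s by (simp add: field_simps power2_eq_square)
  qed
qed

text \<open>A quadratic relation splits into two linear factors, one of which vanishes identically;
  linear independence then makes its coefficients zero.\<close>

lemma products_independent:
  assumes U: "open U" "connected U" and hol: "f holomorphic_on U" "g holomorphic_on U"
    and indep: "\<And>a b. (\<forall>u\<in>U. a * f u + b * g u = 0) \<Longrightarrow> a = 0 \<and> b = 0"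
    and 0: "\<And>u. u \<in> U \<Longrightarrow> \<alpha> * (f u)\<^sup>2 + \<beta> * (f u * g u) + \<gamma> * (g u)\<^sup>2 = 0"
  shows "\<alpha> = 0 \<and> \<beta> = 0 \<and> \<gamma> = 0"
proof -
  obtain a b c d where *: "\<alpha> = a * c" "\<beta> = a * d + b * c" "\<gamma> = b * d"
    by (rule binary_quadratic_factorization)
  have "(a * f u + b * g u) * (c * f u + d * g u) = 0" if "u \<in> U" for u
    using 0[OF that] by (simp add: * power2_eq_square algebra_simps)
  then have "(\<forall>u\<in>U. a * f u + b * g u = 0) \<or> (\<forall>u\<in>U. c * f u + d * g u = 0)"
    by (intro holomorphic_mult_eq_0[OF U] holomorphic_intros hol)
  then have "a = 0 \<and> b = 0 \<or> c = 0 \<and> d = 0"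
    using indep by blast
  then show ?thesis
    using * by auto
qed

section \<open>Independent function vectors and the squared fundamental system\<close>

definition independent_on :: "'u set \<Rightarrow> ('u \<Rightarrow> 'a::comm_ring_1 ^ 'n) \<Rightarrow> bool" where
  "independent_on U q \<longleftrightarrow> (\<forall>v. (\<forall>u\<in>U. (\<Sum>i\<in>UNIV. v $ i * q u $ i) = 0) \<longrightarrow> v = 0)"

lemma independent_on_matrix_eq:
  assumes "independent_on U q" and eq: "\<And>u. u \<in> U \<Longrightarrow> M *v q u = N *v q u"
  shows "M = N"
proof -
  have "row i (M - N) = 0" for i
  proof -
    have "(\<Sum>j\<in>UNIV. row i (M - N) $ j * q u $ j) = (M *v q u - N *v q u) $ i" for u
      by (simp add: row_def matrix_vector_mult_def algebra_simps sum_subtractf)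
    then show ?thesis
      using assms unfolding independent_on_def by simp
  qed
  then show ?thesis
    by (simp add: row_def vec_eq_iff)
qed

text \<open>A kernel vector of \<open>transpose N\<close> is the coefficient vector of a linear
  relation among the entries of \<open>q\<close>.\<close>

lemma independent_on_factor_invertible:
  fixes N :: "'a::field ^ 'n ^ 'n"
  assumes "independent_on U q" and q: "\<And>u. u \<in> U \<Longrightarrow> q u = N *v p u"
  shows "invertible N"
proof -
  have "v = 0" if "transpose N *v v = 0" for v
  proof -
    have "(\<Sum>i\<in>UNIV. v $ i * q u $ i) = (\<Sum>j\<in>UNIV. (transpose N *v v) $ j * p u $ j)"
      if "u \<in> U" for u
      unfolding q[OF that]
      by (simp add: matrix_vector_mult_def transpose_def sum_distrib_left sum_distrib_right
          mult_ac, rule sum.swap)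
    then show ?thesis
      using assms(1) that unfolding independent_on_def by simp
  qed
  then have "invertible (transpose N)"
    by (simp add: invertible_left_inverse matrix_left_invertible_ker)
  then show ?thesis
    by (simp add: invertible_det_nz)
qed

text \<open>The Veronese map onto the null cone of \<open>R_form\<close>; the factor sqrt 2 makes
  linear changes of \<open>x\<close> act by exactly \<open>phi\<close>.\<close>

definition squares :: "complex ^ 2 \<Rightarrow> complex ^ 3" where
  "squares x = vector [(x $ 1)\<^sup>2, of_real (sqrt 2) * (x $ 1 * x $ 2), (x $ 2)\<^sup>2]"

lemma squares_mult:
  "squares (c *s (map_matrix of_real A *v x)) =
     (\<chi> i j. c\<^sup>2 * of_real (phi A $ i $ j)) *v squares x"
proof -
  have [simp]: "complex_of_real (sqrt 2) * (complex_of_real (sqrt 2) * z) = 2 * z" for z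
    by (simp flip: mult.assoc of_real_mult)
  show ?thesis
    by (simp add: vec_eq_iff forall_3 squares_def phi_def Let_def matrix_vector_mult_def sum_2 sum_3
        power2_eq_square algebra_simps)
qed

lemma trace_square_Int_of_similar:
  fixes N :: "complex ^ 3 ^ 3"
  assumes A: "det A = 1" and N: "invertible N"
    and eq: "(\<chi> i j. s * complex_of_real (phi A $ i $ j)) ** N = N ** map_matrix of_int g"
    and g: "\<bar>det g\<bar> = 1"
  shows "(trace A)\<^sup>2 \<in> \<int>"
proof -
  let ?M = "\<chi> i j. s * complex_of_real (phi A $ i $ j)"
  have "det ?M = s ^ 3 * of_real (det (phi A))"
    by (simp add: det_3 algebra_simps power3_eq_cube)
  then have "s ^ 3 = of_int (det g)"
    using det_similar[OF eq N] A by (simp add: det_phi det_map_matrix_of_int)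
  then have "norm (s ^ 3) = 1"
    by (metis g norm_of_int of_int_1 of_int_abs)
  then have s: "norm s = 1"
    by (intro power_eq_imp_eq_base[of _ 3 1]) (simp_all add: norm_power)
  have "trace ?M = s * of_real (trace (phi A))"
    by (simp add: trace_def sum_distrib_left)
  then have "s * of_real (trace (phi A)) = of_int (trace g)"
    using trace_similar[OF eq N] by (simp add: trace_map_matrix_of_int)
  \<comment> \<open>Absolute values remove \<open>s\<close>; since \<open>trace (phi A)\<close> is
    real, they determine it up to sign.\<close>
  then have "norm (s * of_real (trace (phi A))) = norm (of_int (trace g) :: complex)"
    by simp
  then have "\<bar>trace (phi A)\<bar> = of_int \<bar>trace g\<bar>"
    by (simp add: norm_mult s)
  then have "trace (phi A) \<in> \<int>"
    by (metis Ints_of_int Ints_minus abs_if minus_minus)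
  then show ?thesis
    using Ints_add[OF _ Ints_1, of "trace (phi A)"] by (simp add: trace_phi[OF A])
qed

lemma independent_on_squares:
  assumes U: "open U" "connected U" and hol: "\<And>i. (\<lambda>u. f u $ i) holomorphic_on U"
    and indep: "independent_on U f"
  shows "independent_on U (\<lambda>u. squares (f u))"
  unfolding independent_on_def
proof (intro allI impI)
  fix v :: "complex ^ 3"
  assume v: "\<forall>u\<in>U. (\<Sum>i\<in>UNIV. v $ i * squares (f u) $ i) = 0"
  have "a = 0 \<and> b = 0" if "\<forall>u\<in>U. a * f u $ 1 + b * f u $ 2 = 0" for a b
  proof -
    have "vector [a, b] = (0 :: complex ^ 2)"
      using indep that by (simp add: independent_on_def sum_2)
    then show ?thesis
      by (simp add: vec_eq_iff forall_2)
  qed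
  \<comment> \<open>The sqrt 2 in \<open>squares\<close> is absorbed into the middle coefficient of
    the quadratic relation.\<close>
  then have "v $ 1 = 0 \<and> v $ 2 * of_real (sqrt 2) = 0 \<and> v $ 3 = 0"
    by (rule products_independent[OF U hol[of 1] hol[of 2]])
      (use v in \<open>auto simp: squares_def sum_3 mult.assoc\<close>)
  then show "v = 0"
    by (simp add: vec_eq_iff forall_3)
qed

section \<open>Monodromy of the Picard-Fuchs equation\<close>

lemma symmetric_square_picard_fuchs_factor:
  assumes pf: "picard_fuchs t U \<pi> lam \<omega> L" and sym: "symmetric_square U \<pi> lam K L"
    and f: "fundamental_system U \<pi> lam K f"
  obtains N where "\<And>u. u \<in> U \<Longrightarrow> squares (f u) = N *v \<omega> u"
proof -
  have K: "ode_solution U \<pi> lam K (\<lambda>u. f u $ i)" for i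
    using f unfolding fundamental_system_def by blast
  have "ode_solution U \<pi> lam L (\<lambda>u. \<alpha> * (f u $ 1)\<^sup>2 + \<beta> * (f u $ 1 * f u $ 2) + \<gamma> * (f u $ 2)\<^sup>2)"
    for \<alpha> \<beta> \<gamma>
  proof -
    have "\<exists>f' g' \<alpha>' \<beta>' \<gamma>'. ode_solution U \<pi> lam K f' \<and> ode_solution U \<pi> lam K g' \<and>
        (\<forall>u\<in>U. \<alpha> * (f u $ 1)\<^sup>2 + \<beta> * (f u $ 1 * f u $ 2) + \<gamma> * (f u $ 2)\<^sup>2
          = \<alpha>' * (f' u)\<^sup>2 + \<beta>' * (f' u * g' u) + \<gamma>' * (g' u)\<^sup>2)"
      by (rule exI[of _ "\<lambda>u. f u $ 1"], rule exI[of _ "\<lambda>u. f u $ 2"],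
          rule exI[of _ \<alpha>], rule exI[of _ \<beta>], rule exI[of _ \<gamma>]) (simp add: K)
    then show ?thesis
      using sym by (simp add: symmetric_square_def)
  qed
  \<comment> \<open>These coefficient choices produce the three entries of
    \<open>squares (f u)\<close>.\<close>
  from this[of 1 0 0] this[of 0 "of_real (sqrt 2)" 0] this[of 0 0 1]
  have "ode_solution U \<pi> lam L (\<lambda>u. squares (f u) $ i)" for i
    using exhaust_3[of i] by (auto simp: squares_def)
  then have "\<exists>c :: complex ^ 3. \<forall>u\<in>U. squares (f u) $ i = (\<Sum>j\<in>UNIV. c $ j * period t \<omega> j u)" for i
    using pf by (simp add: picard_fuchs_def)
  then obtain C :: "3 \<Rightarrow> complex ^ 3"
    where C: "\<And>i u. u \<in> U \<Longrightarrow> squares (f u) $ i = (\<Sum>j\<in>UNIV. C i $ j * period t \<omega> j u)"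
    by metis
  show thesis
  proof (rule that)
    fix u assume "u \<in> U"
    \<comment> \<open>The periods are the Gram matrix applied to \<omega>, so \<open>N\<close> is
      the matrix of the coefficients \<open>C\<close> times the Gram matrix.\<close>
    have "period t \<omega> j u = (map_matrix of_int (gram t) *v \<omega> u) $ j" for j
      by (simp add: period_def matrix_vector_mult_def)
    then have "squares (f u) = (\<chi> i j. C i $ j) *v (map_matrix of_int (gram t) *v \<omega> u)"
      using C[OF \<open>u \<in> U\<close>] by (simp add: vec_eq_iff matrix_vector_mult_def)
    then show "squares (f u) = ((\<chi> i j. C i $ j) ** map_matrix of_int (gram t)) *v \<omega> u"
      by (simp add: matrix_vector_mul_assoc)
  qed
qed

text \<open>The inverse loop also acts on \<omega> by an integral matrix, which makes the matrix of
  \<gamma> invertible over the integers.\<close>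

lemma deck_transformation_inverse:
  assumes "deck_transformation U \<pi> \<gamma>"
  obtains \<gamma>' where "deck_transformation U \<pi> \<gamma>'"
    "\<And>u. u \<in> U \<Longrightarrow> \<gamma> u \<in> U" "\<And>u. u \<in> U \<Longrightarrow> \<gamma>' (\<gamma> u) = u"
proof -
  obtain \<gamma>' where h: "homeomorphism U U \<gamma> \<gamma>'" and \<pi>: "\<And>u. u \<in> U \<Longrightarrow> \<pi> (\<gamma> u) = \<pi> u"
    using assms by (auto simp: deck_transformation_def)
  have "\<pi> (\<gamma>' u) = \<pi> u" if "u \<in> U" for u
    using \<pi>[of "\<gamma>' u"] h that by (force simp: homeomorphism_def)
  then have "deck_transformation U \<pi> \<gamma>'"
    using homeomorphism_symD[OF h] by (auto simp: deck_transformation_def)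
  then show thesis
    using that h by (auto simp: homeomorphism_def)
qed

lemma continuation_trace_square_Int:
  assumes base: "family_base U \<pi> B lam" and per: "period_datum S t U \<pi> \<omega>"
    and pf: "picard_fuchs t U \<pi> lam \<omega> L" and sym: "symmetric_square U \<pi> lam K L"
    and f: "fundamental_system U \<pi> lam K f"
    and \<gamma>: "deck_transformation U \<pi> \<gamma>" and A: "continues_by U f \<gamma> A"
  shows "(trace A)\<^sup>2 \<in> \<int>"
proof -
  have U: "open U" "connected U"
    using base simply_connected_imp_connected by (auto simp: family_base_def)
  have q: "independent_on U (\<lambda>u. squares (f u))"
    using f unfolding fundamental_system_def ode_solution_def independent_on_def[symmetric]
    by (intro independent_on_squares U) blast+
  obtain N where N: "\<And>u. u \<in> U \<Longrightarrow> squares (f u) = N *v \<omega> u"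
    using symmetric_square_picard_fuchs_factor[OF pf sym f] by blast
  have inv: "invertible N"
    using independent_on_factor_invertible[OF q N] .
  \<comment> \<open>The inverse of \<open>N\<close> transfers the independence of
    \<open>squares (f u)\<close> to \<omega>, so a matrix is determined by its action on
    \<omega>.\<close>
  have \<omega>: "M = M'" if "\<And>u. u \<in> U \<Longrightarrow> M *v \<omega> u = M' *v \<omega> u" for M M' :: "complex ^ 3 ^ 3"
  proof -
    obtain N' where N': "N' ** N = mat 1"
      using inv invertible_left_inverse by blast
    have "N' *v squares (f u) = \<omega> u" if "u \<in> U" for u
      by (simp add: N that matrix_vector_mul_assoc N')
    then have "(M ** N') *v squares (f u) = (M' ** N') *v squares (f u)" if "u \<in> U" for u
      using that \<open>\<And>u. u \<in> U \<Longrightarrow> M *v \<omega> u = M' *v \<omega> u\<close> by (simp flip: matrix_vector_mul_assoc)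
    then have "M ** N' = M' ** N'"
      using independent_on_matrix_eq[OF q] by blast
    then show ?thesis
      by (metis N' matrix_mul_assoc matrix_mul_rid)
  qed
  obtain \<gamma>' where \<gamma>': "deck_transformation U \<pi> \<gamma>'"
    and \<gamma>U: "\<And>u. u \<in> U \<Longrightarrow> \<gamma> u \<in> U" and inverse: "\<And>u. u \<in> U \<Longrightarrow> \<gamma>' (\<gamma> u) = u"
    using deck_transformation_inverse[OF \<gamma>] by blast
  obtain g where g: "\<And>u. u \<in> U \<Longrightarrow> \<omega> (\<gamma> u) = map_matrix of_int g *v \<omega> u"
    using per \<gamma> unfolding period_datum_def by blast
  obtain g' where g': "\<And>u. u \<in> U \<Longrightarrow> \<omega> (\<gamma>' u) = map_matrix of_int g' *v \<omega> u"
    using per \<gamma>' unfolding period_datum_def by blast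
  have "map_matrix complex_of_int g' ** map_matrix of_int g = mat 1"
  proof (rule \<omega>)
    fix u assume "u \<in> U"
    then show "(map_matrix of_int g' ** map_matrix of_int g) *v \<omega> u = mat 1 *v \<omega> u"
      using g'[OF \<gamma>U] g inverse by (simp flip: matrix_vector_mul_assoc)
  qed
  then have "complex_of_int (det g' * det g) = of_int 1"
    by (metis det_I det_mul det_map_matrix_of_int of_int_1 of_int_mult)
  then have "det g' * det g = 1"
    by (simp only: of_int_eq_iff)
  then have "\<bar>det g\<bar> = 1"
    by (metis zmult_eq_1_iff abs_1 abs_minus_cancel)
  obtain c where A1: "det A = 1"
    and c: "\<And>u. u \<in> U \<Longrightarrow> f (\<gamma> u) = c *s (map_matrix of_real A *v f u)"
    using A by (auto simp: continues_by_def)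
  \<comment> \<open>Both sides compute \<open>squares (f (\<gamma> u))\<close>: once by continuing
    \<open>f\<close>, once by continuing \<omega>.\<close>
  have "(\<chi> i j. c\<^sup>2 * of_real (phi A $ i $ j)) ** N = N ** map_matrix of_int g"
  proof (rule \<omega>)
    fix u assume u: "u \<in> U"
    have "((\<chi> i j. c\<^sup>2 * of_real (phi A $ i $ j)) ** N) *v \<omega> u = squares (f (\<gamma> u))"
      by (simp add: c u squares_mult N flip: matrix_vector_mul_assoc)
    then show "((\<chi> i j. c\<^sup>2 * of_real (phi A $ i $ j)) ** N) *v \<omega> u
        = (N ** map_matrix of_int g) *v \<omega> u"
      by (simp add: N \<gamma>U g u flip: matrix_vector_mul_assoc)
  qed
  then show ?thesis
    using trace_square_Int_of_similar A1 inv \<open>\<bar>det g\<bar> = 1\<close> by blast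
qed

section \<open>The group obtained from the moduli space\<close>

lemma Phi_preimage_trace_square_Int:
  assumes P: "transpose P ** map_matrix real_of_int (gram t) ** P = R_form"
    and X: "X \<in> Phi_preimage S t P" and A: "A \<in> X"
  shows "(trace A)\<^sup>2 \<in> \<int>"
proof -
  obtain A' g where A': "det A' = 1" "(trace A)\<^sup>2 = (trace A')\<^sup>2"
    and g: "Phi P A' = map_matrix real_of_int g \<or> Phi P A' = - map_matrix real_of_int g"
    using X A unfolding Phi_preimage_def by (rule trace_square_psl) blast
  have "det R_form = -1"
    by (simp add: R_form_def det_3)
  then have "invertible P"
    using arg_cong[OF P, of det] by (auto simp: det_mul invertible_det_nz)
  then have "trace (phi A') = trace (Phi P A')"
    using trace_similar[of "Phi P A'" P "phi A'"] by (simp add: Phi_def matrix_inv_right_mult)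
  \<comment> \<open>The sign left by passing to O(T) modulo -id does not affect integrality.\<close>
  also have "\<dots> = trace (map_matrix real_of_int g) \<or> \<dots> = - trace (map_matrix real_of_int g)"
    using g by (auto simp: trace_def sum_negf)
  finally have "trace (phi A') \<in> \<int>"
    by (auto simp: trace_map_matrix_of_int)
  then show ?thesis
    using Ints_add[OF _ Ints_1, of "trace (phi A')"] by (simp add: trace_phi[OF A'(1)] A'(2))
qed

theorem theorem1p10:
  fixes S :: "k3_lattice set" and t :: "3 \<Rightarrow> k3_lattice"
    and B :: "'b::t2_space set" and \<Gamma> :: "(real ^ 2 ^ 2) set set"
  assumes "rank19_polarisation S"
    and "zbasis t (orth S)"
    and "picard_fuchs_monodromy S t B \<Gamma> \<or> moduli_monodromy S t \<Gamma>"
  shows "\<forall>X\<in>\<Gamma>. \<forall>A\<in>X. (trace A)\<^sup>2 \<in> \<int>"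
  using assms(3)
proof
  assume "picard_fuchs_monodromy S t B \<Gamma>"
  then obtain U \<pi> lam \<omega> L K f
    where fam: "family_base U \<pi> B lam" "period_datum S t U \<pi> \<omega>" "picard_fuchs t U \<pi> lam \<omega> L"
      "symmetric_square U \<pi> lam K L" "fundamental_system U \<pi> lam K f"
    and \<Gamma>: "\<Gamma> = {psl A | A. \<exists>\<gamma>. deck_transformation U \<pi> \<gamma> \<and> continues_by U f \<gamma> A}"
    unfolding picard_fuchs_monodromy_def by blast
  show ?thesis
  proof (intro ballI)
    fix X A assume "X \<in> \<Gamma>" "A \<in> X"
    then obtain A' \<gamma> where "deck_transformation U \<pi> \<gamma>" "continues_by U f \<gamma> A'"
      "(trace A)\<^sup>2 = (trace A')\<^sup>2"
      unfolding \<Gamma> by (rule trace_square_psl) blast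
    then show "(trace A)\<^sup>2 \<in> \<int>"
      using continuation_trace_square_Int[OF fam] by simp
  qed
next
  assume "moduli_monodromy S t \<Gamma>"
  then obtain P h where P: "transpose P ** map_matrix real_of_int (gram t) ** P = R_form"
    and h: "det h = 1"
    and \<Gamma>: "\<Gamma> = (\<lambda>X. (\<lambda>A. h ** A ** matrix_inv h) ` X) ` Phi_preimage S t P"
    unfolding moduli_monodromy_def by blast
  \<comment> \<open>Traces are invariant under conjugation by \<open>h\<close>, which reduces the
    claim to \<open>Phi_preimage S t P\<close>.\<close>
  have "invertible h"
    using h by (simp add: invertible_det_nz)
  then have "trace (h ** A ** matrix_inv h) = trace A" for A
    using trace_similar[of "h ** A ** matrix_inv h" h A] by (simp add: matrix_inv_right_mult)
  then show ?thesis
    using Phi_preimage_trace_square_Int[OF P] unfolding \<Gamma> by auto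
qed

end
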